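(* Let $p$ be prime, let $H$ be a subgroup of $\mathbb{F}_p^\times$, let $\chi\colon H\to\mathbb{C}^\times$ be a character, and let each of $R$ and $S$ be a complete set of $H$-orbit representatives of $\mathbb{F}_p^\times$ (if $\chi$ is nontrivial) or of $\mathbb{F}_p$ (if $\chi$ is trivial). Then every $(\chi,R,S)$-compressed Fourier matrix has the nonvanishing minors property.
   Context: $\mathbb{F}_p=\mathbb{Z}/p\mathbb{Z}$. A character of $H$ is a group homomorphism $H\to\mathbb{C}^\times$; it is trivial if identically $1$. $H$ acts on $\mathbb{F}_p$ by multiplication; the $H$-orbits are $\{0\}$ and the cosets of $H$ in $\mathbb{F}_p^\times$. A complete set of $H$-orbit representatives contains exactly one element of each orbit. For $s\in\mathbb{F}_p$ let $\epsilon_s\colon\mathbb{F}_p\to\mathbb{C}^\times$, $\epsilon_s(x)=\exp(2\pi i sx/p)$, extended linearly to the group ring $\mathbb{C}[\mathbb{F}_p]$ (elements written $\sum_a f_a[a]$). For $r\in\mathbb{F}_p$ let $u_{\chi,r}=\sum_{h\in H}\chi(h)[hr]\in\mathbb{C}[\mathbb{F}_p]$. A $(\chi,R,S)$-compressed Fourier matrix is a matrix whose rows and columns are indexed respectively by $R$ and $S$ (endowed with some orderings) and whose $(r,s)$-entry is $\epsilon_s(u_{\chi,r})=\sum_{h\in H}\chi(h)\epsilon_s(hr)$. A square matrix has the nonvanishing minors property if the determinant of every square submatrix (obtained by choosing any set of $k$ rows and any set of $k$ columns, $k\ge 1$) is nonzero. *)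

theory Defs
  imports
    Complex_Main
    "HOL-Computational_Algebra.Primes"
    "HOL-Number_Theory.Residues"
    "HOL-Algebra.Group_Action"
    "Jordan_Normal_Form.Determinant"
    "Jordan_Normal_Form.DL_Submatrix"
begin

abbreviation Fp :: "nat \<Rightarrow> int ring" where
  "Fp p \<equiv> residue_ring (int p)"

definition complex_units :: "complex monoid" where
  "complex_units = \<lparr>carrier = UNIV - {0}, monoid.mult = (*), one = 1\<rparr>"

abbreviation subgroup_as_group :: "nat \<Rightarrow> int set \<Rightarrow> int monoid" where
  "subgroup_as_group p H \<equiv> (units_of (Fp p))\<lparr>carrier := H\<rparr>"

definition is_character :: "nat \<Rightarrow> int set \<Rightarrow> (int \<Rightarrow> complex) \<Rightarrow> bool" where
  "is_character p H \<chi> \<longleftrightarrow> \<chi> \<in> hom (subgroup_as_group p H) complex_units"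

definition trivial_character :: "int set \<Rightarrow> (int \<Rightarrow> complex) \<Rightarrow> bool" where
  "trivial_character H \<chi> \<longleftrightarrow> (\<forall>h\<in>H. \<chi> h = 1)"

definition H_orbits :: "nat \<Rightarrow> int set \<Rightarrow> int set \<Rightarrow> int set set" where
  "H_orbits p H E = orbits (subgroup_as_group p H) E (\<lambda>h x. h \<otimes>\<^bsub>Fp p\<^esub> x)"

definition complete_orbit_reps :: "nat \<Rightarrow> int set \<Rightarrow> int set \<Rightarrow> int set \<Rightarrow> bool" where
  "complete_orbit_reps p H E R \<longleftrightarrow>
     R \<subseteq> E \<and> (\<forall>Orb \<in> H_orbits p H E. \<exists>!x. x \<in> R \<and> x \<in> Orb)"

definition orbit_domain :: "nat \<Rightarrow> int set \<Rightarrow> (int \<Rightarrow> complex) \<Rightarrow> int set" where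
  "orbit_domain p H \<chi> =
     (if trivial_character H \<chi> then carrier (Fp p) else Units (Fp p))"

definition eps :: "nat \<Rightarrow> int \<Rightarrow> int \<Rightarrow> complex" where
  "eps p s x = exp (2 * complex_of_real pi * \<i> * of_int s * of_int x / of_nat p)"

text \<open>
  An element of the group ring over the additive group of the prime field is represented by its
  coefficient function, which vanishes off the carrier.
\<close>

definition gr_basis :: "int \<Rightarrow> int \<Rightarrow> complex" where
  "gr_basis a = (\<lambda>b. if b = a then 1 else 0)"

definition eps_linear :: "nat \<Rightarrow> int \<Rightarrow> (int \<Rightarrow> complex) \<Rightarrow> complex" where
  "eps_linear p s f = (\<Sum>a\<in>carrier (Fp p). f a * eps p s a)"

definition u_elem :: "nat \<Rightarrow> int set \<Rightarrow> (int \<Rightarrow> complex) \<Rightarrow> int \<Rightarrow> (int \<Rightarrow> complex)" where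
  "u_elem p H \<chi> r = (\<lambda>b. \<Sum>h\<in>H. \<chi> h * gr_basis (h \<otimes>\<^bsub>Fp p\<^esub> r) b)"

text \<open>
  The orderings of the index sets are lists that enumerate them without repetition.
\<close>

definition compressed_fourier_matrix ::
  "nat \<Rightarrow> int set \<Rightarrow> (int \<Rightarrow> complex) \<Rightarrow> int set \<Rightarrow> int set \<Rightarrow> complex mat \<Rightarrow> bool" where
  "compressed_fourier_matrix p H \<chi> R S M \<longleftrightarrow>
     (\<exists>rs ss. distinct rs \<and> set rs = R \<and> distinct ss \<and> set ss = S \<and>
        M = mat (length rs) (length ss)
              (\<lambda>(i, j). eps_linear p (ss ! j) (u_elem p H \<chi> (rs ! i))))"

definition nonvanishing_minors :: "'a::comm_ring_1 mat \<Rightarrow> bool" where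
  "nonvanishing_minors M \<longleftrightarrow> square_mat M \<and>
     (\<forall>I J. I \<subseteq> {..<dim_row M} \<longrightarrow> J \<subseteq> {..<dim_col M} \<longrightarrow> card I = card J \<longrightarrow> 1 \<le> card I \<longrightarrow>
        det (submatrix M I J) \<noteq> 0)"

lemma eps_linear_u_elem:
  assumes "p > 0"
  shows "eps_linear p s (u_elem p H \<chi> r) = (\<Sum>h\<in>H. \<chi> h * eps p s (h \<otimes>\<^bsub>Fp p\<^esub> r))"
proof -
  have mem: "h \<otimes>\<^bsub>Fp p\<^esub> r \<in> carrier (Fp p)" for h
    using assms by (simp add: residue_ring_def)
  have fin: "finite (carrier (Fp p))"
    by (simp add: residue_ring_def)
  have "eps_linear p s (u_elem p H \<chi> r)
      = (\<Sum>a\<in>carrier (Fp p). \<Sum>h\<in>H. \<chi> h * gr_basis (h \<otimes>\<^bsub>Fp p\<^esub> r) a * eps p s a)"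
    by (simp add: eps_linear_def u_elem_def sum_distrib_right)
  also have "\<dots> = (\<Sum>h\<in>H. \<Sum>a\<in>carrier (Fp p). \<chi> h * gr_basis (h \<otimes>\<^bsub>Fp p\<^esub> r) a * eps p s a)"
    by (rule sum.swap)
  also have "\<dots> = (\<Sum>h\<in>H. \<chi> h * eps p s (h \<otimes>\<^bsub>Fp p\<^esub> r))"
  proof (rule sum.cong[OF refl])
    fix h
    have "(\<Sum>a\<in>carrier (Fp p). \<chi> h * gr_basis (h \<otimes>\<^bsub>Fp p\<^esub> r) a * eps p s a)
        = (\<Sum>a\<in>carrier (Fp p). if a = h \<otimes>\<^bsub>Fp p\<^esub> r then \<chi> h * eps p s a else 0)"
      by (rule sum.cong) (auto simp: gr_basis_def)
    also have "\<dots> = \<chi> h * eps p s (h \<otimes>\<^bsub>Fp p\<^esub> r)"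
      using fin mem by (simp add: sum.delta)
    finally show "(\<Sum>a\<in>carrier (Fp p). \<chi> h * gr_basis (h \<otimes>\<^bsub>Fp p\<^esub> r) a * eps p s a)
        = \<chi> h * eps p s (h \<otimes>\<^bsub>Fp p\<^esub> r)" .
  qed
  finally show ?thesis .
qed

end

theory Submission
  imports Defs "Jordan_Normal_Form.Char_Poly"
begin

text \<open>
  Let \<open>\<zeta> = exp (2 \<pi> \<i> / p)\<close>, \<open>d = |H|\<close>, and let \<open>A\<close> be the ring \<open>\<int>[\<omega>]\<close> for a primitive root of unity \<open>\<omega>\<close>
  of order \<open>p d\<close>, so that \<open>A\<close> contains \<open>\<zeta>\<close> and the values of \<open>\<chi>\<close>. Congruences are taken modulo
  \<open>\<pi> = 1 - \<zeta>\<close>, where \<open>p \<equiv> 0\<close> and every power of \<open>\<zeta>\<close> is \<open>1\<close>.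

  Suppose \<open>g\<close> is a vector over \<open>A\<close> annihilated by a \<open>k\<close> by \<open>k\<close> submatrix with rows \<open>r\<^sub>i\<close> and columns
  \<open>s\<^sub>j\<close>. Then the polynomial \<open>\<Sum> g\<^sub>i \<chi>(h) X\<^bsup>h r\<^sub>i\<^esup>\<close> (exponents reduced modulo \<open>p\<close>) vanishes at
  \<open>\<zeta>\<^sup>w\<close> for every \<open>w\<close> in an orbit of some \<open>s\<^sub>j\<close>, hence modulo \<open>\<pi>\<close> it vanishes at \<open>1\<close> to an order
  equal to the number \<open>n\<close> of these \<open>w\<close>. Its moments give \<open>E\<^sub>m \<Sum> g\<^sub>i r\<^sub>i\<^sup>m \<equiv> 0\<close> for \<open>m < n\<close>, where
  \<open>E\<^sub>m = \<Sum> \<chi>(h) h\<^sup>m\<close> depends only on \<open>m\<close> modulo \<open>d\<close>. The exponents \<open>m = c + d l\<close> with \<open>l < k\<close> form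
  a Vandermonde system in the \<open>r\<^sub>i\<^sup>d\<close>, which are distinct modulo \<open>p\<close> because the \<open>r\<^sub>i\<close> lie in
  distinct orbits; so \<open>E\<^sub>c g\<^sub>i r\<^sub>i\<^sup>c \<equiv> 0\<close>. If \<open>\<chi>\<close> is trivial, \<open>c = 0\<close> suffices, as \<open>E\<^sub>0 = d\<close> is a unit
  modulo \<open>p\<close>; otherwise all \<open>c < d\<close> are available and \<open>\<Sum> E\<^sub>c \<equiv> d\<close>. In both cases \<open>g \<equiv> 0\<close>.

  Dividing by \<open>\<pi>\<close> and repeating, \<open>g\<close> is divisible by all powers of \<open>\<pi>\<close>, so \<open>g = 0\<close>. If a minor
  vanished, a row of its adjugate would be such a vector \<open>g\<close>, and one of its entries is a smaller
  minor, which is nonzero by induction.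
\<close>

section \<open>Subrings and polynomials over them\<close>

locale unital_subring =
  fixes A :: "'a::idom set"
  assumes one_closed [simp, intro]: "1 \<in> A"
    and diff_closed [intro]: "\<And>x y. x \<in> A \<Longrightarrow> y \<in> A \<Longrightarrow> x - y \<in> A"
    and mult_closed [intro]: "\<And>x y. x \<in> A \<Longrightarrow> y \<in> A \<Longrightarrow> x * y \<in> A"
begin

lemma zero_closed [simp, intro]: "0 \<in> A"
  using diff_closed[OF one_closed one_closed] by simp

lemma uminus_closed [intro]: "x \<in> A \<Longrightarrow> - x \<in> A"
  using diff_closed[OF zero_closed, of x] by simp

lemma add_closed [intro]: "x \<in> A \<Longrightarrow> y \<in> A \<Longrightarrow> x + y \<in> A"
  using diff_closed[of x "- y"] uminus_closed by simp

lemma sum_closed [intro]: "(\<And>i. i \<in> I \<Longrightarrow> f i \<in> A) \<Longrightarrow> sum f I \<in> A"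
  by (induction I rule: infinite_finite_induct) auto

lemma prod_closed [intro]: "(\<And>i. i \<in> I \<Longrightarrow> f i \<in> A) \<Longrightarrow> prod f I \<in> A"
  by (induction I rule: infinite_finite_induct) auto

lemma power_closed [intro]: "x \<in> A \<Longrightarrow> x ^ n \<in> A"
  by (induction n) auto

lemma of_nat_closed [simp, intro]: "of_nat n \<in> A"
  by (induction n) auto

lemma of_int_closed [simp, intro]: "of_int k \<in> A"
  by (cases k rule: int_diff_cases) auto

lemma signof_closed [simp, intro]: "signof q \<in> A"
  by (auto simp: sign_def)

lemma det_closed:
  assumes "M \<in> carrier_mat n n" "\<And>i j. i < n \<Longrightarrow> j < n \<Longrightarrow> M $$ (i, j) \<in> A"
  shows "det M \<in> A"
  unfolding det_def'[OF assms(1)] using assms(2)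
  by (intro sum_closed mult_closed prod_closed signof_closed) (auto dest: permutes_in_image)

text \<open>For \<open>a\<close> in \<open>A\<close> this is the principal ideal of
  \<open>a\<close>; a congruence modulo \<open>a\<close> is expressed throughout as membership of a
  difference.\<close>

definition multiples :: "'a \<Rightarrow> 'a set" where
  "multiples a = (*) a ` A"

lemma multiplesI [intro]: "x \<in> A \<Longrightarrow> a * x \<in> multiples a"
  by (auto simp: multiples_def)

lemma multiplesE [elim]:
  assumes "x \<in> multiples a" obtains y where "y \<in> A" "x = a * y"
  using assms by (auto simp: multiples_def)

lemma multiples_zero [simp, intro]: "0 \<in> multiples a"
  using multiplesI[OF zero_closed, of a] by simp

lemma multiples_add [intro]: "x \<in> multiples a \<Longrightarrow> y \<in> multiples a \<Longrightarrow> x + y \<in> multiples a"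
  by (elim multiplesE) (auto simp flip: distrib_left)

lemma multiples_diff [intro]: "x \<in> multiples a \<Longrightarrow> y \<in> multiples a \<Longrightarrow> x - y \<in> multiples a"
  by (elim multiplesE) (auto simp flip: right_diff_distrib)

lemma multiples_mult [intro]: "x \<in> A \<Longrightarrow> y \<in> multiples a \<Longrightarrow> x * y \<in> multiples a"
  by (elim multiplesE) (auto simp: mult.left_commute)

lemma multiples_sum [intro]:
  "(\<And>i. i \<in> I \<Longrightarrow> f i \<in> multiples a) \<Longrightarrow> sum f I \<in> multiples a"
  by (induction I rule: infinite_finite_induct) auto

lemma multiples_diff_iff: "x - y \<in> multiples a \<Longrightarrow> x \<in> multiples a \<longleftrightarrow> y \<in> multiples a"
  using multiples_add[of "x - y" a y] multiples_diff[of x a "x - y"] by auto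

end

section \<open>Polynomials over a subring and their order of vanishing at 1 modulo an
  element\<close>

definition polys_over :: "'a::comm_ring_1 set \<Rightarrow> 'a poly set" where
  "polys_over A = {P. \<forall>i. coeff P i \<in> A}"

context unital_subring
begin

lemma unital_subring_polys_over: "unital_subring (polys_over A)"
proof
  show "1 \<in> polys_over A"
    by (auto simp: polys_over_def coeff_pCons one_pCons split: nat.splits)
qed (auto simp: polys_over_def coeff_mult)

interpretation polys: unital_subring "polys_over A"
  by (rule unital_subring_polys_over)

lemma pCons_closed: "a \<in> A \<Longrightarrow> P \<in> polys_over A \<Longrightarrow> pCons a P \<in> polys_over A"
  by (auto simp: polys_over_def coeff_pCons split: nat.splits)

lemma pCons_closedD:
  assumes "pCons a P \<in> polys_over A"
  shows "a \<in> A" "P \<in> polys_over A"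
proof -
  have "coeff (pCons a P) i \<in> A" for i
    using assms by (auto simp: polys_over_def)
  from this[of 0] this[of "Suc _"] show "a \<in> A" "P \<in> polys_over A"
    by (auto simp: polys_over_def)
qed

lemma zero_poly_closed [simp]: "0 \<in> polys_over A"
  by (auto simp: polys_over_def)

lemma monom_closed: "a \<in> A \<Longrightarrow> monom a n \<in> polys_over A"
  by (auto simp: polys_over_def)

lemma smult_closed: "a \<in> A \<Longrightarrow> P \<in> polys_over A \<Longrightarrow> smult a P \<in> polys_over A"
  by (auto simp: polys_over_def)

lemma pderiv_closed: "P \<in> polys_over A \<Longrightarrow> pderiv P \<in> polys_over A"
  by (auto simp: polys_over_def coeff_pderiv simp del: of_nat_Suc)

lemma poly_closed: "P \<in> polys_over A \<Longrightarrow> x \<in> A \<Longrightarrow> poly P x \<in> A"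
  by (auto simp: polys_over_def poly_altdef)

lemma synthetic_div_closed: "P \<in> polys_over A \<Longrightarrow> x \<in> A \<Longrightarrow> synthetic_div P x \<in> polys_over A"
proof (induction P)
  case (pCons a P)
  then show ?case
    using pCons_closedD[OF pCons.prems(1)] by (auto intro!: pCons_closed poly_closed)
qed simp


text \<open>Division by a monic linear factor stays over \<open>A\<close>. In a domain the factors
  already split off do not vanish at the next root, so it is a root of the cofactor.\<close>

lemma roots_factor:
  assumes "finite Z" "Z \<subseteq> A" "P \<in> polys_over A" "\<And>z. z \<in> Z \<Longrightarrow> poly P z = 0"
  shows "\<exists>G \<in> polys_over A. P = (\<Prod>z\<in>Z. [:- z, 1:]) * G"
  using assms
proof (induction Z rule: finite_induct)
  case (insert z Z)
  then obtain G where G: "G \<in> polys_over A" "P = (\<Prod>z\<in>Z. [:- z, 1:]) * G"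
    by auto
  have "poly (\<Prod>z\<in>Z. [:- z, 1:]) z \<noteq> 0"
    using insert.hyps by (auto simp: poly_prod)
  moreover have "poly P z = 0"
    using insert.prems by simp
  ultimately have "poly G z = 0"
    by (simp add: G)
  then have "G = [:- z, 1:] * synthetic_div G z"
    using synthetic_div_correct'[of z G] by simp
  then have "P = (\<Prod>z\<in>insert z Z. [:- z, 1:]) * synthetic_div G z"
    using insert.hyps G(2) by (simp add: ac_simps del: mult_pCons_left mult_pCons_right)
  moreover have "synthetic_div G z \<in> polys_over A"
    using G insert.prems by (intro synthetic_div_closed) auto
  ultimately show ?case
    by blast
qed auto

text \<open>For \<open>a\<close> in \<open>A\<close> this is the ideal of \<open>A[X]\<close>
  generated by \<open>(X - 1)^n\<close> and \<open>a\<close>: vanishing at 1 to order at least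
  \<open>n\<close> modulo \<open>a\<close>, stated without a quotient ring.\<close>

definition vanishing :: "'a \<Rightarrow> nat \<Rightarrow> 'a poly set" where
  "vanishing a n = {[:- 1, 1:] ^ n * G + smult a K | G K. G \<in> polys_over A \<and> K \<in> polys_over A}"

text \<open>Modulo \<open>a\<close> every factor \<open>X - z\<close> is
  \<open>X - 1\<close>.\<close>

lemma vanishing_prod:
  assumes "finite Z" "\<And>z. z \<in> Z \<Longrightarrow> z - 1 \<in> multiples a" "a \<in> A" "G \<in> polys_over A"
  shows "(\<Prod>z\<in>Z. [:- z, 1:]) * G \<in> vanishing a (card Z)"
  using assms(1,2)
proof (induction Z rule: finite_induct)
  case empty
  have "(\<Prod>z\<in>{}. [:- z, 1:]) * G = [:- 1, 1:] ^ card {} * G + smult a 0"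
    by simp
  then show ?case
    using assms(4) zero_poly_closed unfolding vanishing_def by blast
next
  case (insert z Z)
  then obtain H K where HK: "H \<in> polys_over A" "K \<in> polys_over A"
    "(\<Prod>z\<in>Z. [:- z, 1:]) * G = [:- 1, 1:] ^ card Z * H + smult a K"
    by (auto simp: vanishing_def)
  from insert.prems obtain y where y: "y \<in> A" "z - 1 = a * y"
    by blast
  have z: "[:- z, 1:] = [:- 1, 1:] - smult a [:y:]"
    using y by (simp add: algebra_simps)
  have lin: "[:- 1, 1:] \<in> polys_over A"
    by (intro pCons_closed) auto
  \<comment> \<open>Used with \<open>L = X - 1\<close> and \<open>Y = y\<close>, where
    \<open>z = 1 + a * y\<close>; every term except \<open>L * E\<close> carries the factor
    \<open>a\<close>.\<close>
  have expand: "(L - smult a Y) * (E + smult a K) = L * E + smult a (L * K - Y * (E + smult a K))"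
    for L Y E :: "'a poly"
    by (simp add: algebra_simps smult_diff_right smult_add_right)
  have "(\<Prod>z\<in>insert z Z. [:- z, 1:]) * G = [:- z, 1:] * ([:- 1, 1:] ^ card Z * H + smult a K)"
    using insert.hyps HK(3) by (simp add: mult.assoc del: mult_pCons_left)
  also have "\<dots> = [:- 1, 1:] ^ card (insert z Z) * H
      + smult a ([:- 1, 1:] * K - [:y:] * ([:- 1, 1:] ^ card Z * H + smult a K))"
    using insert.hyps unfolding z expand by (simp add: mult.assoc del: mult_pCons_left)
  finally show ?case
    using HK y lin assms(3) unfolding vanishing_def
    by (blast intro: pCons_closed smult_closed zero_poly_closed)
qed

text \<open>The monomial of exponent \<open>e\<close> is an eigenvector with eigenvalue
  \<open>e\<close>, so iterates produce power moments, where plain derivatives would give falling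
  factorials.\<close>

definition euler_op :: "'a poly \<Rightarrow> 'a poly" where
  "euler_op P = [:0, 1:] * pderiv P"

text \<open>By the Leibniz rule differentiation lowers the order at 1 by at most one, and it
  commutes with the scalar \<open>a\<close>.\<close>

lemma euler_op_vanishing:
  assumes "P \<in> vanishing a (Suc n)"
  shows "euler_op P \<in> vanishing a n"
proof -
  from assms obtain G K where GK: "G \<in> polys_over A" "K \<in> polys_over A"
    "P = [:- 1, 1:] ^ Suc n * G + smult a K"
    by (auto simp: vanishing_def)
  have d: "pderiv [:- 1, 1:] = (1 :: 'a poly)"
    by (simp add: pderiv_pCons one_pCons)
  have "euler_op P = [:- 1, 1:] ^ n * ([:0, 1:] * (smult (of_nat (Suc n)) G + [:- 1, 1:] * pderiv G))
      + smult a ([:0, 1:] * pderiv K)"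
    unfolding euler_op_def GK(3) pderiv_add pderiv_mult pderiv_power_Suc pderiv_smult d
    by (simp add: algebra_simps smult_add_right del: mult_pCons_left mult_pCons_right of_nat_Suc)
  moreover have "[:0, 1:] \<in> polys_over A" "[:- 1, 1:] \<in> polys_over A"
    by (auto intro!: pCons_closed)
  ultimately show ?thesis
    using GK(1,2) unfolding vanishing_def by (blast intro: pderiv_closed smult_closed)
qed

lemma poly_vanishing:
  assumes "P \<in> vanishing a (Suc n)"
  shows "poly P 1 \<in> multiples a"
  using assms by (auto simp: vanishing_def simp del: mult_pCons_left intro!: poly_closed multiplesI)

lemma euler_op_monom_sum:
  "(euler_op ^^ j) (\<Sum>x\<in>X. monom (c x) (e x)) = (\<Sum>x\<in>X. monom (of_nat (e x) ^ j * c x) (e x))"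
proof (induction j)
  case (Suc j)
  have "euler_op (monom b m) = monom (of_nat m * b) m" for b m
    by (cases m) (simp_all add: euler_op_def pderiv_monom flip: monom_Suc)
  moreover have "euler_op (sum f X) = (\<Sum>x\<in>X. euler_op (f x))" for f
    by (simp add: euler_op_def higher_pderiv_sum[of 1, simplified] sum_distrib_left)
  ultimately show ?case
    by (simp add: Suc.IH mult.assoc)
qed simp

text \<open>The sparse polynomial with coefficients \<open>c\<close> and exponents \<open>e\<close>
  has all of \<open>Z\<close> as roots, so modulo \<open>a\<close> it vanishes at 1 to order
  \<open>card Z\<close>. After \<open>j\<close> Euler operators the order is still positive, and the
  value at 1 is the \<open>j\<close>-th moment.\<close>

lemma moments_multiples:
  assumes "a \<in> A" "\<And>x. x \<in> X \<Longrightarrow> c x \<in> A"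
    and "finite Z" "Z \<subseteq> A" "\<And>z. z \<in> Z \<Longrightarrow> z - 1 \<in> multiples a"
    and "\<And>z. z \<in> Z \<Longrightarrow> (\<Sum>x\<in>X. c x * z ^ e x) = 0" "j < card Z"
  shows "(\<Sum>x\<in>X. of_nat (e x) ^ j * c x) \<in> multiples a"
proof -
  define P where "P = (\<Sum>x\<in>X. monom (c x) (e x))"
  have "P \<in> polys_over A"
    unfolding P_def using assms by (intro polys.sum_closed monom_closed) auto
  moreover have "poly P z = 0" if "z \<in> Z" for z
    using assms(6)[OF that] by (simp add: P_def poly_sum poly_monom)
  ultimately obtain G where "G \<in> polys_over A" "P = (\<Prod>z\<in>Z. [:- z, 1:]) * G"
    using roots_factor[of Z P] assms by blast
  then have "P \<in> vanishing a (card Z)"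
    using vanishing_prod assms by blast
  then have "(euler_op ^^ i) P \<in> vanishing a (card Z - i)" if "i < card Z" for i
    using that
  proof (induction i)
    case (Suc i)
    then show ?case
      using euler_op_vanishing[of "(euler_op ^^ i) P" a "card Z - Suc i"] by (simp add: Suc_diff_Suc)
  qed simp
  from this[OF assms(7)] have "poly ((euler_op ^^ j) P) 1 \<in> multiples a"
    using poly_vanishing[of _ a "card Z - Suc j"] assms(7) by (simp add: Suc_diff_Suc)
  then show ?thesis
    unfolding P_def euler_op_monom_sum by (simp add: poly_sum poly_monom)
qed

end

section \<open>Subrings generated by a root of unity\<close>

definition int_adjoin :: "'a::field_char_0 \<Rightarrow> 'a set" where
  "int_adjoin w = range (\<lambda>q. poly (map_poly of_int q) w)"

lemma unital_subring_int_adjoin: "unital_subring (int_adjoin w)"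
proof
  show "1 \<in> int_adjoin w"
    unfolding int_adjoin_def by (intro image_eqI[where x = 1]) auto
  fix x y assume "x \<in> int_adjoin w" "y \<in> int_adjoin w"
  then obtain q r where qr: "x = poly (map_poly of_int q) w" "y = poly (map_poly of_int r) w"
    by (auto simp: int_adjoin_def)
  show "x - y \<in> int_adjoin w"
    unfolding int_adjoin_def qr by (intro image_eqI[where x = "q - r"]) (auto simp: hom_distribs)
  show "x * y \<in> int_adjoin w"
    unfolding int_adjoin_def qr by (intro image_eqI[where x = "q * r"]) (auto simp: hom_distribs)
qed

lemma int_adjoin_self: "w \<in> int_adjoin w"
  unfolding int_adjoin_def by (intro image_eqI[where x = "[:0, 1:]"]) auto

lemma power_mod_exponent:
  fixes w :: "'a::monoid_mult"
  assumes "w ^ N = 1"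
  shows "w ^ (i mod N) = w ^ i"
  by (metis assms mult_1 div_mult_mod_eq mult.commute power_add power_mult power_one)

lemma int_adjoin_root_of_unity:
  assumes "w ^ N = 1" "N > 0" "x \<in> int_adjoin w"
  obtains b :: "nat \<Rightarrow> int" where "x = (\<Sum>j<N. of_int (b j) * w ^ j)"
proof -
  from assms(3) obtain q where q: "x = poly (map_poly of_int q) w"
    by (auto simp: int_adjoin_def)
  have "x = (\<Sum>i\<le>degree q. of_int (coeff q i) * w ^ i)"
    by (simp add: q poly_altdef)
  also have "\<dots> = (\<Sum>j<N. \<Sum>i\<in>{i \<in> {..degree q}. i mod N = j}. of_int (coeff q i) * w ^ i)"
    using assms(2) by (intro sum.group[symmetric]) auto
  also have "\<dots> = (\<Sum>j<N. of_int (\<Sum>i\<in>{i \<in> {..degree q}. i mod N = j}. coeff q i) * w ^ j)"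
    by (intro sum.cong refl)
      (auto simp: sum_distrib_right power_mod_exponent[OF assms(1)] intro!: sum.cong)
  finally show thesis
    by (rule that)
qed

text \<open>On the spanning set of the powers \<open>w\<^sup>i\<close> with \<open>i < N\<close>, multiplication by \<open>x\<close> is an integer matrix with eigenvalue \<open>x\<close>.\<close>

lemma int_adjoin_algebraic_int:
  assumes "w ^ N = 1" "N > 0" "x \<in> int_adjoin w"
  shows "algebraic_int x"
proof -
  interpret unital_subring "int_adjoin w"
    by (rule unital_subring_int_adjoin)
  have "\<exists>b :: nat \<Rightarrow> int. x * w ^ i = (\<Sum>j<N. of_int (b j) * w ^ j)" for i
  proof -
    have "x * w ^ i \<in> int_adjoin w"
      using assms(3) int_adjoin_self by blast
    then show ?thesis
      using int_adjoin_root_of_unity[OF assms(1,2)] by metis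
  qed
  then obtain B :: "nat \<Rightarrow> nat \<Rightarrow> int" where B: "x * w ^ i = (\<Sum>j<N. of_int (B i j) * w ^ j)" for i
    by metis
  define M where "M = mat N N (\<lambda>(i, j). B i j)"
  define v where "v = vec N (\<lambda>i. w ^ i)"
  have M: "M \<in> carrier_mat N N"
    by (simp add: M_def)
  have "v $ 0 \<noteq> 0"
    using assms(2) by (simp add: v_def)
  then have "v \<noteq> 0\<^sub>v N"
    using assms(2) by auto
  moreover have "map_mat of_int M *\<^sub>v v = x \<cdot>\<^sub>v v"
    by (intro eq_vecI)
      (auto simp: M_def v_def B scalar_prod_def atLeast0LessThan intro!: sum.cong)
  ultimately have "eigenvector (map_mat of_int M) v x"
    by (simp add: eigenvector_def M_def v_def)
  then have "poly (char_poly (map_mat of_int M)) x = 0"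
    using eigenvalue_root_char_poly[of "map_mat of_int M" N x] M by (auto simp: eigenvalue_def)
  then have "poly (map_poly of_int (char_poly M)) x = 0"
    using of_int_hom.char_poly_hom[OF M, where 'a = 'a] by simp
  then show ?thesis
    using degree_monic_char_poly[OF M] by (auto simp: algebraic_int_altdef_ipoly)
qed

text \<open>The constant term of an integer polynomial with root \<open>x\<close> is a multiple of
  \<open>x\<close>; if it is zero, a factor \<open>X\<close> is cancelled, as
  \<open>x \<noteq> 0\<close>. This replaces the norm of \<open>x\<close>.\<close>

lemma algebraic_int_dvd_int:
  fixes A :: "'a::field_char_0 set"
  assumes "unital_subring A" "algebraic_int x" "x \<in> A" "x \<noteq> 0"
  shows "\<exists>m. m \<noteq> 0 \<and> of_int m \<in> unital_subring.multiples A x"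
proof -
  interpret unital_subring A
    by (rule assms(1))
  have "\<exists>m. m \<noteq> 0 \<and> of_int m \<in> multiples x"
    if "q \<noteq> 0" "poly (map_poly of_int q) x = 0" for q :: "int poly"
    using that
  proof (induction q)
    case (pCons a q)
    have eq: "of_int a = x * - poly (map_poly of_int q) x"
      using pCons.prems by (simp add: eq_neg_iff_add_eq_0)
    have "map_poly of_int q \<in> polys_over A"
      by (simp add: polys_over_def)
    then have "of_int a \<in> multiples x"
      unfolding eq using assms(3) by (blast intro: poly_closed)
    moreover have "poly (map_poly of_int q) x = 0" if "a = 0"
      using eq that assms(4) by simp
    ultimately show ?case
      using pCons.IH pCons.prems by (cases "a = 0") auto
  qed simp
  then show ?thesis
    using assms(2) by (metis algebraic_int_altdef_ipoly leading_coeff_0_iff zero_neq_one)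
qed

text \<open>A nonzero \<open>x\<close> divides some nonzero integer \<open>m\<close>. As
  \<open>p\<close> divides a power of \<open>a\<close>, every power of \<open>p\<close> would divide
  \<open>m\<close> in the ring, hence in the integers; the exponent \<open>n = \<bar>m\<bar>\<close>
  is already too large.\<close>

lemma int_adjoin_infinitely_divisible:
  assumes "w ^ N = 1" "N > 0" "x \<in> int_adjoin w"
    and a: "a ^ k \<in> unital_subring.multiples (int_adjoin w) (of_nat p)" "p > 1"
    and x: "\<And>m. x \<in> unital_subring.multiples (int_adjoin w) (a ^ m)"
  shows "x = 0"
proof (rule ccontr)
  interpret unital_subring "int_adjoin w"
    by (rule unital_subring_int_adjoin)
  assume "x \<noteq> 0"
  then obtain m y where m: "m \<noteq> 0" "y \<in> int_adjoin w" "of_int m = x * y"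
    using algebraic_int_dvd_int[OF unital_subring_int_adjoin int_adjoin_algebraic_int]
      assms(1-3) by blast
  define n where "n = nat \<bar>m\<bar>"
  obtain u where u: "u \<in> int_adjoin w" "a ^ k = of_nat p * u"
    using a by blast
  obtain z where z: "z \<in> int_adjoin w" "x = a ^ (k * n) * z"
    using x by blast
  \<comment> \<open>The quotient of \<open>m\<close> by \<open>p ^ n\<close>, built from ring
    elements so that it is visibly an algebraic integer; being rational, it is an integer.\<close>
  define t where "t = u ^ n * z * y"
  have t: "t \<in> int_adjoin w"
    using u z m by (auto simp: t_def)
  have eq: "of_int m = of_nat p ^ n * t"
    by (simp add: m(3) z(2) power_mult u(2) power_mult_distrib t_def)
  then have "t = of_int m / of_nat p ^ n"
    using a(2) by simp
  then have "t \<in> \<rat>"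
    by (auto intro!: Rats_divide)
  then have "t \<in> \<int>"
    using rational_algebraic_int_is_int int_adjoin_algebraic_int[OF assms(1,2) t] by blast
  then obtain b where b: "t = of_int b"
    by (elim Ints_cases)
  have "(of_int m :: 'a) = of_int (int p ^ n * b)"
    using eq b by simp
  then have "m = int p ^ n * b"
    by (simp only: of_int_eq_iff)
  then have "int p ^ n \<le> \<bar>m\<bar>"
    using m(1) by (metis abs_of_nat dvd_imp_le_int dvd_triv_left of_nat_power)
  moreover have "n < p ^ n"
    using a(2) by (simp add: power_gt_expt)
  then have "int n < int p ^ n"
    by (metis of_nat_less_iff of_nat_power)
  ultimately show False
    by (simp add: n_def)
qed

section \<open>Characters of subgroups of the multiplicative group\<close>

lemma Units_residue_ring_prime:
  assumes "prime p"
  shows "Units (Fp p) = {1..<int p}"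
proof -
  have "residues (int p)"
    using prime_gt_1_nat[OF assms] by (simp add: residues_def)
  moreover have "coprime x (int p)" if "0 < x" "x < int p" for x
    using that assms zdvd_not_zless[OF that] prime_imp_coprime[of "int p" x]
    by (simp add: coprime_commute)
  ultimately show ?thesis
    by (auto simp: residues.res_units_eq)
qed

locale subgroup_character =
  fixes p :: nat and H :: "int set" and \<chi> :: "int \<Rightarrow> complex"
  assumes prime: "prime p"
    and subgroup: "subgroup H (units_of (Fp p))"
    and character: "is_character p H \<chi>"
begin

lemma p_gt_1: "p > 1"
  using prime prime_gt_1_nat by blast

lemma H_subset: "H \<subseteq> {1..<int p}"
  using subgroup.subset[OF subgroup] Units_residue_ring_prime[OF prime]
  by (simp add: units_of_def)

lemma finite_H: "finite H"
  using H_subset finite_subset by blast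

lemma not_dvd_H: "h \<in> H \<Longrightarrow> \<not> int p dvd h"
  using H_subset zdvd_not_zless by auto

lemma coprime_p: "\<not> int p dvd a \<Longrightarrow> coprime a (int p)"
  using prime prime_imp_coprime[of "int p" a] by (simp add: coprime_commute)

lemma coprime_H: "h \<in> H \<Longrightarrow> coprime h (int p)"
  by (simp add: coprime_p not_dvd_H)

lemma one_in_H: "1 \<in> H"
  using subgroup.one_closed[OF subgroup] by (simp add: units_of_def residue_ring_def)

lemma mult_in_H: "h \<in> H \<Longrightarrow> k \<in> H \<Longrightarrow> h * k mod int p \<in> H"
  using subgroup.m_closed[OF subgroup, of h k] by (simp add: units_of_def residue_ring_def)

lemma chi_mult: "h \<in> H \<Longrightarrow> k \<in> H \<Longrightarrow> \<chi> (h * k mod int p) = \<chi> h * \<chi> k"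
  using character
  by (auto simp: is_character_def hom_def complex_units_def units_of_def residue_ring_def)

lemma chi_nonzero: "h \<in> H \<Longrightarrow> \<chi> h \<noteq> 0"
  using character by (auto simp: is_character_def hom_def complex_units_def)

lemma bij_betw_mult_H:
  assumes "h \<in> H"
  shows "bij_betw (\<lambda>k. h * k mod int p) H H"
proof -
  have "inj_on (\<lambda>k. h * k mod int p) H"
  proof (rule inj_onI)
    fix k l assume kl: "k \<in> H" "l \<in> H" "h * k mod int p = h * l mod int p"
    then have "[h * k = h * l] (mod int p)"
      by (simp add: cong_def)
    moreover have "coprime h (int p)"
      by (rule coprime_H[OF assms])
    ultimately have "[k = l] (mod int p)"
      by (simp add: cong_mult_lcancel)
    then show "k = l"
      using H_subset kl by (intro cong_less_imp_eq_int) auto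
  qed
  moreover have "(\<lambda>k. h * k mod int p) ` H \<subseteq> H"
    using mult_in_H[OF assms] by blast
  ultimately show ?thesis
    using finite_H by (simp add: bij_betw_def endo_inj_surj)
qed

abbreviation "d \<equiv> card H"

lemma d_pos: "d > 0"
  using finite_H one_in_H by (auto simp: card_gt_0_iff)

text \<open>Translation by \<open>h\<close> permutes \<open>H\<close>, so the product over
  \<open>H\<close> absorbs the factor \<open>h ^ d\<close>; \<open>chi_power_d\<close> repeats this
  for the values of \<open>\<chi>\<close>.\<close>

lemma power_d_cong: "h \<in> H \<Longrightarrow> [h ^ d = 1] (mod int p)"
proof -
  assume h: "h \<in> H"
  have "(\<Prod>k\<in>H. k) = (\<Prod>k\<in>H. h * k mod int p)"
    using prod.reindex_bij_betw[OF bij_betw_mult_H[OF h], of "\<lambda>k. k"] by simp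
  also have "[\<dots> = (\<Prod>k\<in>H. h * k)] (mod int p)"
    by (intro cong_prod) (simp add: cong_def)
  also have "(\<Prod>k\<in>H. h * k) = h ^ d * (\<Prod>k\<in>H. k)"
    by (simp add: prod.distrib)
  finally have "[h ^ d * (\<Prod>k\<in>H. k) = 1 * (\<Prod>k\<in>H. k)] (mod int p)"
    by (simp add: cong_sym)
  moreover have "coprime (\<Prod>k\<in>H. k) (int p)"
    by (intro prod_coprime_left coprime_H)
  ultimately show ?thesis
    using cong_mult_rcancel by blast
qed

lemma chi_power_d:
  assumes "h \<in> H"
  shows "\<chi> h ^ d = 1"
proof -
  have "(\<Prod>k\<in>H. \<chi> k) = (\<Prod>k\<in>H. \<chi> (h * k mod int p))"
    using prod.reindex_bij_betw[OF bij_betw_mult_H[OF assms], of \<chi>] by simp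
  also have "\<dots> = \<chi> h ^ d * (\<Prod>k\<in>H. \<chi> k)"
    by (simp add: chi_mult[OF assms] prod.distrib)
  finally show ?thesis
    using chi_nonzero finite_H by (auto simp: prod_zero_iff)
qed

lemma chi_1: "\<chi> 1 = 1"
  using chi_mult[OF one_in_H one_in_H] chi_nonzero[OF one_in_H] p_gt_1 by simp

text \<open>Multiplication by \<open>h - 1\<close>, which is prime to \<open>p\<close>, telescopes
  the sum to \<open>h ^ d - 1\<close>.\<close>

lemma geometric_sum_H:
  assumes "h \<in> H" "h \<noteq> 1"
  shows "[(\<Sum>c<d. h ^ c) = 0] (mod int p)"
proof -
  have "(h - 1) * (\<Sum>c<d. h ^ c) = h ^ d - 1"
    by (simp add: power_diff_1_eq)
  then have "int p dvd (h - 1) * (\<Sum>c<d. h ^ c)"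
    using power_d_cong[OF assms(1)] by (simp add: cong_iff_dvd_diff)
  moreover have "\<not> int p dvd h - 1"
    using assms H_subset zdvd_not_zless[of "h - 1" "int p"] by auto
  ultimately show ?thesis
    using prime by (simp add: cong_0_iff prime_dvd_mult_iff)
qed

text \<open>The elements of \<open>H\<close> are \<open>d\<close> roots of \<open>X^d - 1\<close>
  modulo \<open>p\<close>, and a prime modulus allows no further ones.\<close>

lemma mem_H_if_power_cong:
  assumes "[x ^ d = 1] (mod int p)"
  shows "x mod int p \<in> H"
proof -
  define T where "T = {y \<in> {..<p}. [y ^ d = 1] (mod p)}"
  have "nat ` H \<subseteq> T"
  proof
    fix y assume "y \<in> nat ` H"
    then obtain h where h: "h \<in> H" "y = nat h"
      by blast
    have "int y = h"
      using h H_subset by auto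
    then have "[int (y ^ d) = int 1] (mod int p)"
      using power_d_cong[OF h(1)] by simp
    then have "[y ^ d = 1] (mod p)"
      by (simp only: cong_int_iff)
    moreover have "int y < int p"
      using h(1) H_subset \<open>int y = h\<close> by auto
    ultimately show "y \<in> T"
      by (simp add: T_def)
  qed
  moreover have "card T \<le> d"
    unfolding T_def using d_pos prime roots_mod_prime_bound[of p d 1] by simp
  moreover have "card (nat ` H) = d"
    using H_subset by (intro card_image inj_onI) (auto dest!: subsetD)
  ultimately have "nat ` H = T"
    by (intro card_seteq) (auto simp: T_def)
  moreover have "nat (x mod int p) \<in> T"
  proof -
    have "[int (nat (x mod int p)) ^ d = x ^ d] (mod int p)"
      using p_gt_1 by (intro cong_pow) (simp add: cong_def)
    then have "[int (nat (x mod int p) ^ d) = int 1] (mod int p)"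
      using cong_trans[OF _ assms] by simp
    then show ?thesis
      using p_gt_1 unfolding cong_int_iff by (auto simp: T_def nat_less_iff)
  qed
  ultimately obtain h where "h \<in> H" "nat h = nat (x mod int p)"
    by auto
  moreover have "x mod int p \<ge> 0" "h \<ge> 0"
    using p_gt_1 \<open>h \<in> H\<close> H_subset by auto
  ultimately show ?thesis
    by (simp add: eq_nat_nat_iff)
qed

text \<open>For \<open>r\<close> prime to \<open>p\<close>, the quotient of \<open>s\<close> by
  \<open>r\<close> is a \<open>d\<close>-th root of unity and hence in \<open>H\<close>. Thus
  \<open>d\<close>-th powers separate orbits and can serve as Vandermonde nodes.\<close>

lemma power_d_cong_imp_orbit:
  assumes "[r ^ d = s ^ d] (mod int p)"
  shows "\<exists>h\<in>H. [h * r = s] (mod int p)"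
proof (cases "int p dvd r")
  case True
  then have "int p dvd r ^ d"
    using d_pos by (intro dvd_trans[OF _ dvd_power]) auto
  then have "int p dvd s ^ d"
    using cong_trans[OF cong_sym[OF assms], of 0] by (simp add: cong_0_iff)
  then have "int p dvd s"
    using prime prime_dvd_power_int_iff[of "int p" d s] d_pos by simp
  then have "[1 * r = s] (mod int p)"
    using True by (simp add: cong_iff_dvd_diff)
  then show ?thesis
    using one_in_H by blast
next
  case False
  then have "coprime r (int p)"
    by (rule coprime_p)
  then obtain u where u: "[r * u = 1] (mod int p)"
    using cong_solve_coprime_int by blast
  have "[(s * u) ^ d = (r * u) ^ d] (mod int p)"
    unfolding power_mult_distrib using assms by (intro cong_mult) (auto simp: cong_sym)
  also have "[(r * u) ^ d = 1 ^ d] (mod int p)"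
    using u by (rule cong_pow)
  finally have "s * u mod int p \<in> H"
    using mem_H_if_power_cong by simp
  moreover have "[s * u mod int p * r = s * (r * u)] (mod int p)"
    by (simp add: cong_def mod_simps ac_simps)
  moreover have "[s * (r * u) = s] (mod int p)"
    using cong_mult[OF cong_refl[of s] u] by simp
  ultimately show ?thesis
    using cong_trans by blast
qed

end

section \<open>Congruences in a cyclotomic ring\<close>

definition zeta :: "nat \<Rightarrow> int \<Rightarrow> complex" where
  "zeta p t = cis (2 * pi * of_int t / of_nat p)"

lemma eps_eq_zeta: "eps p s x = zeta p (s * x)"
  by (simp add: eps_def zeta_def cis_conv_exp mult_ac)

lemma zeta_0 [simp]: "zeta p 0 = 1"
  by (simp add: zeta_def)

lemma zeta_add: "zeta p (s + t) = zeta p s * zeta p t"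
  by (simp add: zeta_def cis_mult ring_distribs add_divide_distrib)

lemma zeta_power: "zeta p t ^ n = zeta p (int n * t)"
  by (simp add: zeta_def DeMoivre mult_ac)

lemma zeta_cong:
  assumes "[s = t] (mod int p)" "p > 0"
  shows "zeta p s = zeta p t"
proof -
  obtain k where "s = t + int p * k"
    using assms(1) by (metis cong_iff_lin cong_sym)
  moreover have "zeta p (int p * k) = 1"
    using assms(2) cis_multiple_2pi[of "of_int k"] by (simp add: zeta_def mult_ac)
  ultimately show ?thesis
    by (simp add: zeta_add)
qed

lemma inj_on_zeta: "inj_on (zeta p) {0..<int p}"
proof (cases "p = 0")
  case False
  have "inj_on (\<lambda>k. cis (2 * pi * real k / real p)) {..<p}"
    using bij_betw_roots_unity[of p] False by (simp add: bij_betw_def)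
  then have "inj_on (\<lambda>k. zeta p (int k)) {..<p}"
    by (simp add: zeta_def)
  moreover have "{0..<int p} = int ` {..<p}"
    by (simp add: image_int_atLeastLessThan lessThan_atLeast0)
  ultimately show ?thesis
    by (auto simp: inj_on_def)
qed auto

context subgroup_character
begin

definition cyc_ring :: "complex set" where
  "cyc_ring = int_adjoin (zeta (p * d) 1)"

sublocale cyc: unital_subring cyc_ring
  unfolding cyc_ring_def by (rule unital_subring_int_adjoin)

lemma root_of_unity_closed:
  assumes "x ^ (p * d) = 1"
  shows "x \<in> cyc_ring"
proof -
  have "p * d > 0"
    using d_pos p_gt_1 by simp
  then have "x \<in> (\<lambda>k. cis (2 * pi * real k / real (p * d))) ` {..<p * d}"
    using bij_betw_imp_surj_on[OF bij_betw_roots_unity[of "p * d"]] assms by simp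
  then obtain k where "x = zeta (p * d) 1 ^ k"
    by (auto simp: zeta_power) (simp add: zeta_def)
  then show ?thesis
    using int_adjoin_self[of "zeta (p * d) 1"] cyc.power_closed by (simp add: cyc_ring_def)
qed

lemma zeta_closed: "zeta p t \<in> cyc_ring"
proof (rule root_of_unity_closed)
  have "zeta p (int (p * d) * t) = zeta p 0"
    using p_gt_1 by (intro zeta_cong) (auto simp: cong_0_iff)
  then show "zeta p t ^ (p * d) = 1"
    by (simp add: zeta_power)
qed

lemma chi_closed: "h \<in> H \<Longrightarrow> \<chi> h \<in> cyc_ring"
  using chi_power_d[of h] by (intro root_of_unity_closed) (simp add: power_mult mult.commute[of p])

section \<open>Arithmetic modulo the uniformizer\<close>

definition uniformizer :: complex where
  "uniformizer = 1 - zeta p 1"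

abbreviation mul_pi :: "complex set" where
  "mul_pi \<equiv> cyc.multiples uniformizer"

lemma uniformizer_closed: "uniformizer \<in> cyc_ring"
  unfolding uniformizer_def using zeta_closed by blast

lemma zeta_minus_1: "zeta p t - 1 \<in> mul_pi"
proof -
  \<comment> \<open>A nonnegative exponent is needed for the geometric sum.\<close>
  define n where "n = nat (t mod int p)"
  have "zeta p t = zeta p (int n)"
    using p_gt_1 by (intro zeta_cong) (auto simp: n_def cong_def)
  then have "zeta p t - 1 = zeta p 1 ^ n - 1"
    by (simp add: zeta_power)
  also have "\<dots> = uniformizer * - (\<Sum>i<n. zeta p 1 ^ i)"
    unfolding power_diff_1_eq uniformizer_def by (simp add: algebra_simps)
  also have "\<dots> \<in> mul_pi"
    using zeta_closed by blast
  finally show ?thesis .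
qed

lemma zeta_1_ne_1: "zeta p 1 \<noteq> 1"
  using inj_onD[OF inj_on_zeta[of p], of 1 0] p_gt_1 by auto

lemma zeta_1_power_p: "zeta p 1 ^ p = 1"
  using zeta_cong[of "int p" 0 p] p_gt_1 by (simp add: zeta_power cong_0_iff)

text \<open>The \<open>p\<close>-th roots of unity sum to zero, so \<open>p\<close> is minus the sum
  of the differences \<zeta>^i - 1.\<close>

lemma p_mul_pi: "of_nat p \<in> mul_pi"
proof -
  have "(zeta p 1 - 1) * (\<Sum>i<p. zeta p 1 ^ i) = 0"
    using zeta_1_power_p by (simp flip: power_diff_1_eq)
  then have "(\<Sum>i<p. zeta p 1 ^ i) = 0"
    using zeta_1_ne_1 by simp
  then have "of_nat p = - (\<Sum>i<p. zeta p (int i) - 1)"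
    by (simp add: zeta_power sum_subtractf)
  moreover have "0 - (\<Sum>i<p. zeta p (int i) - 1) \<in> mul_pi"
    by (intro cyc.multiples_diff cyc.multiples_sum zeta_minus_1 cyc.multiples_zero)
  ultimately show ?thesis
    by simp
qed

lemma of_int_mul_pi: "[a = b] (mod int p) \<Longrightarrow> of_int a - of_int b \<in> mul_pi"
proof -
  assume "[a = b] (mod int p)"
  then obtain k where "a - b = int p * k"
    by (auto simp: cong_iff_dvd_diff)
  then have "of_int a - of_int b = of_int k * (of_nat p :: complex)"
    by (metis mult.commute of_int_diff of_int_mult of_int_of_nat_eq)
  then show ?thesis
    using p_mul_pi by (auto simp del: of_int_mult)
qed

text \<open>In the binomial expansion \<open>p\<close> divides all inner coefficients. This converts
  divisibility by powers of the uniformizer into divisibility by powers of \<open>p\<close>.\<close>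

lemma uniformizer_power_p: "uniformizer ^ p \<in> cyc.multiples (of_nat p)"
proof -
  define z where "z = - zeta p 1"
  have z: "z \<in> cyc_ring"
    unfolding z_def using zeta_closed by blast
  have "uniformizer ^ p = (z + 1) ^ p"
    by (simp add: z_def uniformizer_def)
  also have "\<dots> = (\<Sum>k\<le>p. of_nat (p choose k) * z ^ k)"
    by (simp add: binomial_ring)
  also have "{..p} = insert 0 (insert p {1..<p})"
    using p_gt_1 by auto
  also have "(\<Sum>k\<in>\<dots>. of_nat (p choose k) * z ^ k) = 1 + z ^ p + (\<Sum>k\<in>{1..<p}. of_nat (p choose k) * z ^ k)"
    using p_gt_1 by simp
  finally have "uniformizer ^ p = \<dots>" .
  moreover have "1 + z ^ p \<in> cyc.multiples (of_nat p)"
  proof -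
    \<comment> \<open>The two outer terms cancel for odd \<open>p\<close> and add up to 2 for
      \<open>p = 2\<close>.\<close>
    have "1 + z ^ p = of_nat p * of_nat (of_bool (p = 2))"
      using zeta_1_power_p prime_odd_nat[OF prime] p_gt_1
      by (auto simp: z_def power_minus_odd)
    also have "\<dots> \<in> cyc.multiples (of_nat p)"
      by (intro cyc.multiplesI cyc.of_nat_closed)
    finally show ?thesis .
  qed
  moreover have "of_nat (p choose k) * z ^ k \<in> cyc.multiples (of_nat p)" if k: "k \<in> {1..<p}" for k
  proof -
    have "p dvd p choose k"
      using prime k by (intro dvd_choose_prime) auto
    then obtain q where "p choose k = p * q"
      by blast
    then have "of_nat (p choose k) * z ^ k = of_nat p * (of_nat q * z ^ k)"
      by simp
    also have "\<dots> \<in> cyc.multiples (of_nat p)"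
      using z by (intro cyc.multiplesI cyc.mult_closed cyc.power_closed cyc.of_nat_closed)
    finally show ?thesis .
  qed
  ultimately show ?thesis
    by (simp only: cyc.multiples_add cyc.multiples_sum)
qed

lemma infinitely_divisible:
  assumes "x \<in> cyc_ring" "\<And>m. x \<in> cyc.multiples (uniformizer ^ m)"
  shows "x = 0"
proof (rule int_adjoin_infinitely_divisible)
  show "zeta (p * d) 1 ^ (p * d) = 1"
    using zeta_cong[of "int (p * d)" 0 "p * d"] p_gt_1 d_pos by (simp add: zeta_power cong_0_iff)
  show "p * d > 0"
    using p_gt_1 d_pos by simp
qed (use assms uniformizer_power_p p_gt_1 in \<open>simp_all add: cyc_ring_def\<close>)

text \<open>An inverse of \<open>a\<close> modulo \<open>p\<close> is also one modulo the
  uniformizer, which divides \<open>p\<close>.\<close>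

lemma mul_pi_cancel:
  assumes "\<not> int p dvd a" "y \<in> cyc_ring" "of_int a * y \<in> mul_pi"
  shows "y \<in> mul_pi"
proof -
  obtain u where "[a * u = 1] (mod int p)"
    using cong_solve_coprime_int[OF coprime_p[OF assms(1)]] by blast
  then have "y * (of_int 1 - of_int (a * u)) \<in> mul_pi"
    using assms(2) by (intro cyc.multiples_mult of_int_mul_pi) (auto simp: cong_sym)
  moreover have "of_int u * (of_int a * y) \<in> mul_pi"
    by (rule cyc.multiples_mult[OF cyc.of_int_closed assms(3)])
  ultimately have "y * (of_int 1 - of_int (a * u)) + of_int u * (of_int a * y) \<in> mul_pi"
    by (rule cyc.multiples_add)
  moreover have "y * (of_int 1 - of_int (a * u)) + of_int u * (of_int a * y) = y"
    by (simp add: algebra_simps)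
  ultimately show ?thesis
    by metis
qed

text \<open>The Lagrange polynomial \<open>L\<close> vanishes at all nodes except \<open>w i\<close>
  and has degree \<open>k - 1\<close>, so combining the relations with its coefficients isolates
  \<open>L(w i) * y i\<close>. The factor \<open>L(w i)\<close> is a product of node differences
  prime to \<open>p\<close>.\<close>

lemma vandermonde_mul_pi:
  fixes w :: "nat \<Rightarrow> int"
  assumes "\<And>i. i < k \<Longrightarrow> y i \<in> cyc_ring"
    and "\<And>i j. i < k \<Longrightarrow> j < k \<Longrightarrow> [w i = w j] (mod int p) \<Longrightarrow> i = j"
    and "\<And>l. l < k \<Longrightarrow> (\<Sum>i<k. y i * of_int (w i) ^ l) \<in> mul_pi"
    and "i < k"
  shows "y i \<in> mul_pi"
proof -
  define L where "L = (\<Prod>m\<in>{..<k} - {i}. [:- w m, 1:])"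
  have "degree L = k - 1"
    using assms(4) by (simp add: L_def degree_prod_eq_sum_degree)
  have L: "poly L x = (\<Prod>m\<in>{..<k} - {i}. x - w m)" for x
    by (simp add: L_def poly_prod)
  have "\<not> int p dvd poly L (w i)"
    using assms(2,4) prime unfolding L by (auto simp: prime_dvd_prod_iff cong_iff_dvd_diff)
  moreover have "of_int (poly L (w i)) * y i \<in> mul_pi"
  proof -
    have "of_int (poly L x) = (\<Sum>l<k. of_int (coeff L l) * (of_int x :: complex) ^ l)" for x
      using \<open>degree L = k - 1\<close> assms(4) by (simp add: poly_altdef lessThan_Suc_atMost[symmetric])
    then have "(\<Sum>m<k. y m * of_int (poly L (w m)))
        = (\<Sum>m<k. \<Sum>l<k. y m * (of_int (coeff L l) * of_int (w m) ^ l))"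
      by (simp add: sum_distrib_left)
    also have "\<dots> = (\<Sum>l<k. of_int (coeff L l) * (\<Sum>m<k. y m * of_int (w m) ^ l))"
      by (subst sum.swap) (simp add: sum_distrib_left mult.left_commute)
    also have "\<dots> \<in> mul_pi"
      by (intro cyc.multiples_sum cyc.multiples_mult[OF cyc.of_int_closed assms(3)]) simp
    also have "(\<Sum>m<k. y m * of_int (poly L (w m))) = (\<Sum>m\<in>{i}. y m * of_int (poly L (w m)))"
    proof (rule sum.mono_neutral_right)
      show "\<forall>m\<in>{..<k} - {i}. y m * of_int (poly L (w m)) = 0"
        using prod_zero[of "{..<k} - {i}"] unfolding L by auto
    qed (use assms(4) in auto)
    finally show ?thesis
      by (simp add: mult.commute)
  qed
  ultimately show ?thesis
    using assms(1,4) mul_pi_cancel by blast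
qed

section \<open>Gauss sums and their power moments\<close>

definition gauss_sum :: "int \<Rightarrow> complex" where
  "gauss_sum t = (\<Sum>h\<in>H. \<chi> h * zeta p (h * t))"

lemma eps_linear_eq_gauss_sum: "eps_linear p s (u_elem p H \<chi> r) = gauss_sum (r * s)"
proof -
  have "eps p s (h \<otimes>\<^bsub>Fp p\<^esub> r) = zeta p (h * (r * s))" for h
    unfolding eps_eq_zeta using p_gt_1
    by (intro zeta_cong) (auto simp: residue_ring_def cong_def mod_simps ac_simps)
  then show ?thesis
    using p_gt_1 by (simp add: eps_linear_u_elem gauss_sum_def)
qed

text \<open>Substitution of \<open>h * k\<close> for \<open>k\<close> in the sum; it spreads a
  kernel relation from one column index to its whole orbit.\<close>

lemma gauss_sum_mult:
  assumes "h \<in> H"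
  shows "\<chi> h * gauss_sum (h * t) = gauss_sum t"
proof -
  have "gauss_sum t = (\<Sum>k\<in>H. \<chi> (h * k mod int p) * zeta p (h * k mod int p * t))"
    unfolding gauss_sum_def by (rule sum.reindex_bij_betw[OF bij_betw_mult_H[OF assms], symmetric])
  also have "\<dots> = (\<Sum>k\<in>H. \<chi> h * (\<chi> k * zeta p (k * (h * t))))"
  proof (rule sum.cong)
    fix k assume "k \<in> H"
    have "zeta p (h * k mod int p * t) = zeta p (k * (h * t))"
      using p_gt_1 by (intro zeta_cong) (auto simp: cong_def mod_simps ac_simps)
    then show "\<chi> (h * k mod int p) * zeta p (h * k mod int p * t) = \<chi> h * (\<chi> k * zeta p (k * (h * t)))"
      using chi_mult[OF assms \<open>k \<in> H\<close>] by simp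
  qed simp
  finally show ?thesis
    by (simp add: gauss_sum_def sum_distrib_left)
qed

lemma gauss_sum_closed: "gauss_sum t \<in> cyc_ring"
  unfolding gauss_sum_def by (intro cyc.sum_closed cyc.mult_closed chi_closed zeta_closed)

definition power_moment :: "nat \<Rightarrow> complex" where
  "power_moment j = (\<Sum>h\<in>H. \<chi> h * of_int h ^ j)"

lemma power_moment_closed: "power_moment j \<in> cyc_ring"
  unfolding power_moment_def
  by (intro cyc.sum_closed cyc.mult_closed cyc.power_closed chi_closed cyc.of_int_closed)

text \<open>Since \<open>h ^ d\<close> is 1 modulo \<open>p\<close> on \<open>H\<close>, all
  exponents \<open>c + d * l\<close> share one moment as a common factor.\<close>

lemma power_moment_periodic: "power_moment (c + d * l) - power_moment c \<in> mul_pi"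
proof -
  have "power_moment (c + d * l) - power_moment c
      = (\<Sum>h\<in>H. \<chi> h * (of_int (h ^ (c + d * l)) - of_int (h ^ c)))"
    by (simp add: power_moment_def sum_subtractf right_diff_distrib)
  also have "\<dots> \<in> mul_pi"
  proof (intro cyc.multiples_sum cyc.multiples_mult of_int_mul_pi)
    fix h assume h: "h \<in> H"
    show "\<chi> h \<in> cyc_ring"
      using h by (rule chi_closed)
    have "[h ^ c * (h ^ d) ^ l = h ^ c * 1 ^ l] (mod int p)"
      by (intro cong_mult cong_pow power_d_cong h) simp
    then show "[h ^ (c + d * l) = h ^ c] (mod int p)"
      by (simp add: power_add power_mult)
  qed
  finally show ?thesis .
qed

text \<open>After exchanging sums the inner sum is geometric: it equals \<open>d\<close> for
  \<open>h = 1\<close> and vanishes modulo \<open>p\<close> otherwise.\<close>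

lemma sum_power_moments: "(\<Sum>c<d. power_moment c) - of_nat d \<in> mul_pi"
proof -
  have "(\<Sum>c<d. power_moment c) = (\<Sum>h\<in>H. \<chi> h * of_int (\<Sum>c<d. h ^ c))"
    unfolding power_moment_def by (subst sum.swap) (simp add: sum_distrib_left)
  also have "\<dots> = of_nat d + (\<Sum>h\<in>H - {1}. \<chi> h * (of_int (\<Sum>c<d. h ^ c) - of_int 0))"
    using sum.remove[OF finite_H one_in_H, of "\<lambda>h. \<chi> h * of_int (\<Sum>c<d. h ^ c)"]
    by (simp add: chi_1)
  finally have "(\<Sum>c<d. power_moment c) - of_nat d
      = (\<Sum>h\<in>H - {1}. \<chi> h * (of_int (\<Sum>c<d. h ^ c) - of_int 0))"
    by simp
  also have "\<dots> \<in> mul_pi"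
    by (intro cyc.multiples_sum cyc.multiples_mult of_int_mul_pi geometric_sum_H chi_closed) auto
  finally show ?thesis .
qed

lemma not_p_dvd_d: "\<not> int p dvd int d"
proof -
  have "d < p"
    using card_mono[OF _ H_subset] p_gt_1 by simp
  then show ?thesis
    using d_pos by (simp add: nat_dvd_not_less)
qed

section \<open>Orbit counting and kernel vectors\<close>

definition inequivalent :: "nat \<Rightarrow> (nat \<Rightarrow> int) \<Rightarrow> bool" where
  "inequivalent k r \<longleftrightarrow> (\<forall>i<k. \<forall>j<k. \<forall>h\<in>H. [h * r i = r j] (mod int p) \<longrightarrow> i = j)"

lemma inequivalent_comp:
  assumes "inequivalent n r" "inj_on f {..<k}" "\<And>i. i < k \<Longrightarrow> f i < n"
  shows "inequivalent k (\<lambda>i. r (f i))"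
  using assms(1,3) inj_onD[OF assms(2)] unfolding inequivalent_def by (meson lessThan_iff)

text \<open>Orbits of distinct indices are disjoint, and nonzero ones have \<open>d\<close>
  elements. If all are nonzero there are \<open>d * k\<close> points; if one is zero there are
  \<open>d * (k - 1) + 1\<close>, which suffices because then \<open>c = 0\<close>.\<close>

lemma card_orbits_lower_bound:
  assumes "inequivalent k s" "c < d" "l < k" "c = 0 \<or> (\<forall>j<k. \<not> int p dvd s j)"
  shows "c + d * l < card ((\<lambda>(h, j). h * s j mod int p) ` (H \<times> {..<k}))" (is "_ < card ?W")
proof -
  define J where "J = {j. j < k \<and> \<not> int p dvd s j}"
  define f where "f = (\<lambda>(h, j). h * s j mod int p)"
  have fin: "finite (f ` (H \<times> {..<k}))"
    using finite_H by simp
  have eq: "j = j'" if hj: "h \<in> H" "h' \<in> H" "j < k" "j' < k" "[h * s j = h' * s j'] (mod int p)"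
    for h h' j j'
  proof -
    \<comment> \<open>The inverse of \<open>h'\<close> in \<open>H\<close>, from surjectivity of
      multiplication by \<open>h'\<close>.\<close>
    obtain u where u: "u \<in> H" "h' * u mod int p = 1"
      using bij_betw_imp_surj_on[OF bij_betw_mult_H[OF hj(2)]] one_in_H by force
    have "[(u * h mod int p) * s j = u * (h * s j)] (mod int p)"
      by (simp add: cong_def mod_simps ac_simps)
    also have "[u * (h * s j) = u * (h' * s j')] (mod int p)"
      using cong_mult[OF cong_refl[of u] hj(5)] .
    also have "u * (h' * s j') = (h' * u) * s j'"
      by simp
    also have "[(h' * u) * s j' = 1 * s j'] (mod int p)"
      using u(2) p_gt_1 by (intro cong_mult) (auto simp: cong_def)
    finally have "[(u * h mod int p) * s j = s j'] (mod int p)"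
      by simp
    then show ?thesis
      using assms(1) hj mult_in_H[OF u(1) hj(1)] unfolding inequivalent_def by blast
  qed
  have "inj_on f (H \<times> J)"
  proof (rule inj_onI, clarify)
    fix h j h' j'
    assume hj: "h \<in> H" "j \<in> J" "h' \<in> H" "j' \<in> J" "f (h, j) = f (h', j')"
    then have *: "[h * s j = h' * s j'] (mod int p)"
      by (simp add: f_def cong_def)
    then have j: "j = j'"
      using hj by (intro eq[of h h']) (auto simp: J_def)
    then have "[h = h'] (mod int p)"
      using * hj coprime_p[of "s j"] by (simp add: J_def cong_mult_rcancel)
    then have "h = h'"
      using hj H_subset by (intro cong_less_imp_eq_int) auto
    then show "h = h' \<and> j = j'"
      using j by simp
  qed
  then have card_f: "card (f ` (H \<times> J)) = d * card J"
    by (simp add: card_image card_cartesian_product)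
  show ?thesis
  proof (cases "J = {..<k}")
    case True
    have "c + d * l < d * Suc l"
      using assms(2) by simp
    also have "\<dots> \<le> d * k"
      using assms(3) by (intro mult_le_mono) auto
    finally show ?thesis
      using card_f True by (simp add: f_def)
  next
    case False
    then obtain j where j: "j < k" "int p dvd s j"
      by (auto simp: J_def)
    then have c: "c = 0"
      using assms(4) by auto
    \<comment> \<open>At most one index can represent the zero orbit.\<close>
    have "{..<k} - {j} \<subseteq> J"
    proof
      fix i assume i: "i \<in> {..<k} - {j}"
      have "\<not> int p dvd s i"
      proof
        assume "int p dvd s i"
        then have "[1 * s i = 1 * s j] (mod int p)"
          using j by (simp add: cong_iff_dvd_diff)
        then have "i = j"
          using i j by (intro eq[of 1 1]) (auto simp: one_in_H)
        then show False
          using i by simp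
      qed
      then show "i \<in> J"
        using i by (simp add: J_def)
    qed
    then have "card ({..<k} - {j}) \<le> card J"
      by (intro card_mono) (auto simp: J_def)
    then have "l \<le> card J"
      using assms(3) j by simp
    \<comment> \<open>The zero orbit contributes the one extra point that makes the bound
      strict.\<close>
    have "0 \<notin> f ` (H \<times> J)"
      using not_dvd_H prime by (auto simp: f_def J_def prime_dvd_mult_iff dvd_eq_mod_eq_0[symmetric] eq_commute[of 0])
    moreover have "0 \<in> f ` (H \<times> {..<k})"
      using one_in_H j by (auto simp: f_def intro!: image_eqI[where x = "(1, j)"])
    ultimately have "f ` (H \<times> J) \<subset> f ` (H \<times> {..<k})"
      by (auto simp: J_def)
    then have "card (f ` (H \<times> J)) < card (f ` (H \<times> {..<k}))"
      using fin by (rule psubset_card_mono[rotated])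
    moreover have "d * l \<le> d * card J"
      using \<open>l \<le> card J\<close> by (rule mult_le_mono2)
    ultimately have "c + d * l < card (f ` (H \<times> {..<k}))"
      using card_f c by linarith
    then show ?thesis
      by (simp only: f_def)
  qed
qed

text \<open>Applies \<open>moments_multiples\<close> to the roots \<zeta>^w with \<open>w\<close> in
  the orbits of the \<open>s j\<close>; the resulting moment factors modulo \<open>p\<close> into an
  \<open>H\<close> part and a part in the \<open>r i\<close>.\<close>

lemma kernel_moments:
  fixes k :: nat and r s :: "nat \<Rightarrow> int"
  assumes g: "\<And>i. i < k \<Longrightarrow> g i \<in> cyc_ring"
    and ker: "\<And>j. j < k \<Longrightarrow> (\<Sum>i<k. g i * gauss_sum (r i * s j)) = 0"
    and m: "m < card ((\<lambda>(h, j). h * s j mod int p) ` (H \<times> {..<k}))" (is "_ < card ?W")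
  shows "power_moment m * (\<Sum>i<k. g i * of_int (r i) ^ m) \<in> mul_pi"
proof -
  define X where "X = {..<k} \<times> H"
  define c where "c = (\<lambda>(i, h). g i * \<chi> h)"
  \<comment> \<open>Reduction modulo \<open>p\<close> makes the exponents natural numbers and leaves
    the values at \<open>p\<close>-th roots of unity unchanged.\<close>
  define e where "e = (\<lambda>(i, h). nat (h * r i mod int p))"
  have "(\<Sum>x\<in>X. of_nat (e x) ^ m * c x) \<in> mul_pi"
  proof (rule cyc.moments_multiples[where Z = "zeta p ` ?W"])
    fix z assume "z \<in> zeta p ` ?W"
    then obtain h' j where hj: "h' \<in> H" "j < k" "z = zeta p (h' * s j mod int p)"
      by auto
    show "z - 1 \<in> mul_pi"
      unfolding hj by (rule zeta_minus_1)
    have z: "z ^ e (i, h) = zeta p (h * (h' * (r i * s j)))" for i h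
    proof -
      have "[int (e (i, h)) * (h' * s j mod int p) = (h * r i) * (h' * s j)] (mod int p)"
        using p_gt_1 by (intro cong_mult) (auto simp: e_def cong_def)
      then have "[int (e (i, h)) * (h' * s j mod int p) = h * (h' * (r i * s j))] (mod int p)"
        by (simp add: ac_simps)
      then show ?thesis
        unfolding hj zeta_power using p_gt_1 by (intro zeta_cong) auto
    qed
    have "(\<Sum>x\<in>X. c x * z ^ e x) = (\<Sum>i<k. \<Sum>h\<in>H. g i * \<chi> h * z ^ e (i, h))"
      unfolding X_def by (simp add: sum.cartesian_product c_def case_prod_beta)
    also have "\<dots> = (\<Sum>i<k. g i * gauss_sum (h' * (r i * s j)))"
      by (simp add: z gauss_sum_def sum_distrib_left mult.assoc)
    \<comment> \<open>The relation is known only at \<open>s j\<close>; the nonzero factor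
      \<open>\<chi> h'\<close> brings the one at \<open>h' * s j\<close> back to it.\<close>
    also have "\<chi> h' * \<dots> = (\<Sum>i<k. g i * (\<chi> h' * gauss_sum (h' * (r i * s j))))"
      by (simp add: sum_distrib_left mult_ac)
    also have "\<dots> = 0"
      using ker[OF hj(2)] by (simp add: gauss_sum_mult[OF hj(1)])
    finally show "(\<Sum>x\<in>X. c x * z ^ e x) = 0"
      using chi_nonzero[OF hj(1)] by simp
  next
    \<comment> \<open>On reduced residues \<open>zeta p\<close> is injective, so there are as many
      roots as orbit points.\<close>
    have "?W \<subseteq> {0..<int p}"
      using p_gt_1 by auto
    then show "m < card (zeta p ` ?W)"
      using m by (simp add: card_image inj_on_subset[OF inj_on_zeta])
  qed (use g finite_H in \<open>auto simp: X_def c_def uniformizer_closed zeta_closed intro!: cyc.mult_closed chi_closed\<close>)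
  \<comment> \<open>Undoing the reduction of the exponents changes the moment only by multiples of
    \<open>p\<close>.\<close>
  moreover have "(\<Sum>x\<in>X. of_nat (e x) ^ m * c x) - power_moment m * (\<Sum>i<k. g i * of_int (r i) ^ m) \<in> mul_pi"
  proof -
    have "power_moment m * (\<Sum>i<k. g i * of_int (r i) ^ m)
        = (\<Sum>i<k. \<Sum>h\<in>H. of_int ((h * r i) ^ m) * (g i * \<chi> h))"
      unfolding power_moment_def sum_product
      by (subst sum.swap) (simp add: power_mult_distrib mult_ac)
    also have "\<dots> = (\<Sum>(i, h)\<in>X. of_int ((h * r i) ^ m) * (g i * \<chi> h))"
      by (simp add: X_def sum.cartesian_product)
    finally have eq: "(\<Sum>x\<in>X. of_nat (e x) ^ m * c x) - power_moment m * (\<Sum>i<k. g i * of_int (r i) ^ m)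
        = (\<Sum>(i, h)\<in>X. g i * \<chi> h * (of_int ((h * r i mod int p) ^ m) - of_int ((h * r i) ^ m)))"
      using p_gt_1
      by (simp add: e_def c_def case_prod_beta algebra_simps flip: sum_subtractf)
    show ?thesis
      unfolding eq using g unfolding X_def
      by (auto intro!: cyc.multiples_sum cyc.multiples_mult of_int_mul_pi cyc.mult_closed chi_closed cong_pow
          simp del: of_int_power simp: cong_def)
  qed
  ultimately show ?thesis
    using cyc.multiples_diff_iff by blast
qed

text \<open>For fixed \<open>c\<close> the moments of exponent \<open>c + d * l\<close> form a
  Vandermonde system with nodes \<open>r i ^ d\<close> and unknowns
  \<open>power_moment c * (g i * of_int (r i) ^ c)\<close>.\<close>

lemma kernel_mul_pi:
  assumes r: "inequivalent k r" and s: "inequivalent k s"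
    and triv: "trivial_character H \<chi> \<or> (\<forall>i<k. \<not> int p dvd r i \<and> \<not> int p dvd s i)"
    and g: "\<And>i. i < k \<Longrightarrow> g i \<in> cyc_ring"
    and ker: "\<And>j. j < k \<Longrightarrow> (\<Sum>i<k. g i * gauss_sum (r i * s j)) = 0"
    and i: "i < k"
  shows "g i \<in> mul_pi"
proof -
  have moment: "power_moment c * (g i * of_int (r i) ^ c) \<in> mul_pi"
    if c: "c < d" "c = 0 \<or> (\<forall>j<k. \<not> int p dvd s j)" for c
  proof (rule vandermonde_mul_pi[where k = k and w = "\<lambda>i. r i ^ d"
        and y = "\<lambda>i. power_moment c * (g i * of_int (r i) ^ c)"])
    fix l assume l: "l < k"
    define Y where "Y = (\<Sum>i<k. g i * of_int (r i) ^ (c + d * l))"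
    have Y: "Y \<in> cyc_ring"
      unfolding Y_def using g by (intro cyc.sum_closed cyc.mult_closed cyc.power_closed) auto
    have "power_moment (c + d * l) * Y \<in> mul_pi"
      unfolding Y_def
      by (rule kernel_moments[OF g ker card_orbits_lower_bound[OF s c(1) l c(2)]])
    moreover have "Y * (power_moment (c + d * l) - power_moment c) \<in> mul_pi"
      by (rule cyc.multiples_mult[OF Y power_moment_periodic])
    then have "power_moment (c + d * l) * Y - power_moment c * Y \<in> mul_pi"
      by (simp add: algebra_simps)
    ultimately have "power_moment c * Y \<in> mul_pi"
      using cyc.multiples_diff_iff by blast
    also have "power_moment c * Y = (\<Sum>i<k. power_moment c * (g i * of_int (r i) ^ c) * of_int (r i ^ d) ^ l)"
      by (simp add: Y_def sum_distrib_left power_add power_mult mult.assoc)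
    finally show "(\<Sum>i<k. power_moment c * (g i * of_int (r i) ^ c) * of_int (r i ^ d) ^ l) \<in> mul_pi" .
  next
    fix i j assume "i < k" "j < k" "[r i ^ d = r j ^ d] (mod int p)"
    then show "i = j"
      using power_d_cong_imp_orbit r unfolding inequivalent_def by blast
  qed (use g i power_moment_closed in \<open>auto intro!: cyc.mult_closed\<close>)
  show ?thesis
  proof (cases "trivial_character H \<chi>")
    \<comment> \<open>Zero may be among the indices here, so only \<open>c = 0\<close> is
      used.\<close>
    case True
    then have "power_moment 0 = of_int (int d)"
      by (simp add: power_moment_def trivial_character_def)
    then have "of_int (int d) * g i \<in> mul_pi"
      using moment[of 0] d_pos by simp
    then show ?thesis
      using mul_pi_cancel[OF not_p_dvd_d g[OF i]] by blast
  next
    case False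
    then have nz: "\<not> int p dvd r j" "\<not> int p dvd s j" if "j < k" for j
      using triv that by auto
    \<comment> \<open>No single moment is shown to be a unit; each product is a multiple of the
      uniformizer, and summing over \<open>c\<close> replaces the moments by
      \<open>d\<close>.\<close>
    have "power_moment c * g i \<in> mul_pi" if "c < d" for c
    proof (rule mul_pi_cancel)
      show "\<not> int p dvd r i ^ c"
        using nz(1)[OF i] prime prime_dvd_power[of "int p" "r i" c] by auto
      show "of_int (r i ^ c) * (power_moment c * g i) \<in> mul_pi"
        using moment[OF that] nz by (simp add: mult_ac)
    qed (intro cyc.mult_closed power_moment_closed g i)
    then have "(\<Sum>c<d. power_moment c) * g i \<in> mul_pi"
      unfolding sum_distrib_right by (intro cyc.multiples_sum) auto
    moreover have "(\<Sum>c<d. power_moment c) * g i - of_int (int d) * g i \<in> mul_pi"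
      using cyc.multiples_mult[OF g[OF i] sum_power_moments] by (simp add: algebra_simps)
    ultimately have "of_int (int d) * g i \<in> mul_pi"
      using cyc.multiples_diff_iff by blast
    then show ?thesis
      using mul_pi_cancel[OF not_p_dvd_d g[OF i]] by blast
  qed
qed

text \<open>Infinite descent: the relations are homogeneous, so a kernel vector divided by the
  nonzero uniformizer is again a kernel vector over the ring.\<close>

lemma kernel_trivial:
  assumes "inequivalent k r" "inequivalent k s"
    and "trivial_character H \<chi> \<or> (\<forall>i<k. \<not> int p dvd r i \<and> \<not> int p dvd s i)"
    and g: "\<And>i. i < k \<Longrightarrow> g i \<in> cyc_ring"
    and ker: "\<And>j. j < k \<Longrightarrow> (\<Sum>i<k. g i * gauss_sum (r i * s j)) = 0"
    and i: "i < k"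
  shows "g i = 0"
proof (rule infinitely_divisible[OF g[OF i]])
  fix m
  \<comment> \<open>The induction ranges over all kernel vectors, since its hypothesis is applied to
    the quotient \<open>y\<close>.\<close>
  from g ker have "\<forall>i<k. g i \<in> cyc.multiples (uniformizer ^ m)"
  proof (induction m arbitrary: g)
    case 0
    then show ?case
      by (simp add: cyc.multiples_def)
  next
    case (Suc m)
    have "\<exists>y. y \<in> cyc_ring \<and> g i = uniformizer * y" if "i < k" for i
      using kernel_mul_pi[OF assms(1-3) Suc.prems that] by (auto simp: cyc.multiples_def)
    then obtain y where y: "\<And>i. i < k \<Longrightarrow> y i \<in> cyc_ring \<and> g i = uniformizer * y i"
      by metis
    have "uniformizer \<noteq> 0"
      using zeta_1_ne_1 by (simp add: uniformizer_def)
    moreover have "uniformizer * (\<Sum>i<k. y i * gauss_sum (r i * s j)) = 0" if "j < k" for j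
      using Suc.prems(2)[OF that] y by (simp add: sum_distrib_left mult.assoc)
    ultimately have IH: "\<forall>i<k. y i \<in> cyc.multiples (uniformizer ^ m)"
      using y by (intro Suc.IH) auto
    show ?case
    proof (intro allI impI)
      fix i assume i: "i < k"
      then obtain z where "z \<in> cyc_ring" "y i = uniformizer ^ m * z"
        using IH by blast
      moreover from this have "g i = uniformizer ^ Suc m * z"
        using y[OF i] by simp
      ultimately show "g i \<in> cyc.multiples (uniformizer ^ Suc m)"
        by (simp only: cyc.multiplesI)
    qed
  qed
  then show "g i \<in> cyc.multiples (uniformizer ^ m)"
    using i by blast
qed

lemma det_gauss_sum_nonzero:
  assumes "inequivalent k r" "inequivalent k s"
    and "trivial_character H \<chi> \<or> (\<forall>i<k. \<not> int p dvd r i \<and> \<not> int p dvd s i)"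
  shows "det (mat k k (\<lambda>(i, j). gauss_sum (r i * s j))) \<noteq> 0"
  using assms
proof (induction k arbitrary: r s)
  case (Suc k)
  define M where "M = mat (Suc k) (Suc k) (\<lambda>(i, j). gauss_sum (r i * s j))"
  have M: "M \<in> carrier_mat (Suc k) (Suc k)"
    by (simp add: M_def)
  show ?case
  proof
    assume "det (mat (Suc k) (Suc k) (\<lambda>(i, j). gauss_sum (r i * s j))) = 0"
    then have adj: "adj_mat M * M = 0 \<cdot>\<^sub>m 1\<^sub>m (Suc k)"
      using adj_mat(3)[OF M] by (simp add: M_def)
    \<comment> \<open>Row 0 of the adjugate consists of the cofactors of column 0.\<close>
    have ker: "(\<Sum>i<Suc k. cofactor M i 0 * gauss_sum (r i * s j)) = 0" if j: "j < Suc k" for j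
    proof -
      have "(adj_mat M * M) $$ (0, j) = (\<Sum>i<Suc k. adj_mat M $$ (0, i) * M $$ (i, j))"
        using j adj_mat(1)[OF M] M by (simp add: scalar_prod_def atLeast0LessThan)
      also have "\<dots> = (\<Sum>i<Suc k. cofactor M i 0 * gauss_sum (r i * s j))"
        using j by (intro sum.cong) (auto simp: M_def adj_mat_def)
      finally show ?thesis
        using j by (simp add: adj)
    qed
    have "cofactor M i 0 \<in> cyc_ring" if "i < Suc k" for i
      unfolding cofactor_def using M
      by (intro cyc.mult_closed cyc.power_closed cyc.uminus_closed cyc.one_closed
          cyc.det_closed[OF mat_delete_carrier[OF M]])
        (auto simp: mat_delete_def M_def gauss_sum_closed)
    then have "cofactor M 0 0 = 0"
      by (rule kernel_trivial[OF Suc.prems _ ker]) simp_all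
    then have "det (mat_delete M 0 0) = 0"
      by (simp add: cofactor_def)
    moreover have "mat_delete M 0 0 = mat k k (\<lambda>(i, j). gauss_sum (r (Suc i) * s (Suc j)))"
      by (rule eq_matI) (auto simp: mat_delete_def M_def)
    moreover have "det (mat k k (\<lambda>(i, j). gauss_sum (r (Suc i) * s (Suc j)))) \<noteq> 0"
    proof (rule Suc.IH)
      show "inequivalent k (\<lambda>i. r (Suc i))" "inequivalent k (\<lambda>i. s (Suc i))"
        by (intro inequivalent_comp[OF _ inj_Suc, of "Suc k"] Suc.prems(1,2); simp)+
    qed (use Suc.prems(3) in auto)
    ultimately show False
      by simp
  qed
\<comment> \<open>The empty determinant is 1.\<close>
qed simp

section \<open>Orbit representatives and the compressed Fourier matrix\<close>

lemma H_orbits_eq: "H_orbits p H E = (\<lambda>x. (\<lambda>h. h * x mod int p) ` H) ` E"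
  by (auto simp: H_orbits_def orbits_def orbit_def residue_ring_def)

lemma orbit_eq:
  assumes "h \<in> H"
  shows "(\<lambda>k. k * (h * x mod int p) mod int p) ` H = (\<lambda>k. k * x mod int p) ` H"
proof -
  have "(\<lambda>k. k * (h * x mod int p) mod int p) ` H = (\<lambda>k. k * x mod int p) ` (\<lambda>k. h * k mod int p) ` H"
    unfolding image_image by (intro image_cong) (simp_all add: mod_mult_left_eq mod_mult_right_eq ac_simps)
  then show ?thesis
    using bij_betw_imp_surj_on[OF bij_betw_mult_H[OF assms]] by simp
qed

lemma mod_orbit_domain: "x \<in> orbit_domain p H \<chi> \<Longrightarrow> x mod int p = x"
  using Units_residue_ring_prime[OF prime]
  by (auto simp: orbit_domain_def residue_ring_def split: if_splits)

lemma orbit_domain_not_dvd: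
  assumes "\<not> trivial_character H \<chi>" "x \<in> orbit_domain p H \<chi>"
  shows "\<not> int p dvd x"
  using assms Units_residue_ring_prime[OF prime] zdvd_not_zless by (auto simp: orbit_domain_def)

text \<open>Both elements lie in the orbit of \<open>r\<close>, which contains only one
  representative.\<close>

lemma orbit_reps_unique:
  assumes "complete_orbit_reps p H (orbit_domain p H \<chi>) R"
    and "r \<in> R" "r' \<in> R" "h \<in> H" "[h * r = r'] (mod int p)"
  shows "r = r'"
proof -
  have sub: "r \<in> orbit_domain p H \<chi>" "r' \<in> orbit_domain p H \<chi>"
    using assms by (auto simp: complete_orbit_reps_def)
  define X where "X = (\<lambda>h. h * r mod int p) ` H"
  have "X \<in> H_orbits p H (orbit_domain p H \<chi>)"
    unfolding X_def H_orbits_eq using sub(1) by (rule imageI)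
  then have unique: "\<exists>!x. x \<in> R \<and> x \<in> X"
    using assms(1) by (simp add: complete_orbit_reps_def)
  have "r = 1 * r mod int p"
    using mod_orbit_domain[OF sub(1)] by simp
  then have r: "r \<in> X"
    unfolding X_def using one_in_H by (rule image_eqI)
  have "r' = h * r mod int p"
    using assms(5) mod_orbit_domain[OF sub(2)] by (simp add: cong_def)
  then have r': "r' \<in> X"
    unfolding X_def using assms(4) by (rule image_eqI)
  show ?thesis
    using unique assms(2,3) r r' by auto
qed

text \<open>Representatives correspond bijectively to orbits; applied to \<open>R\<close> and
  \<open>S\<close>, this makes the matrix square.\<close>

lemma card_orbit_reps:
  assumes "complete_orbit_reps p H (orbit_domain p H \<chi>) R"
  shows "card R = card (H_orbits p H (orbit_domain p H \<chi>))"
proof (rule bij_betw_same_card)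
  let ?f = "\<lambda>x. (\<lambda>h. h * x mod int p) ` H"
  show "bij_betw ?f R (H_orbits p H (orbit_domain p H \<chi>))"
    unfolding bij_betw_def
  proof (intro conjI inj_onI equalityI subsetI)
    fix r r' assume r: "r \<in> R" "r' \<in> R" "?f r = ?f r'"
    have "r' \<in> orbit_domain p H \<chi>"
      using r assms by (auto simp: complete_orbit_reps_def)
    then have "r' = 1 * r' mod int p"
      using mod_orbit_domain by simp
    then have "r' \<in> ?f r'"
      using one_in_H by (rule image_eqI)
    then obtain h where h: "h \<in> H" "r' = h * r mod int p"
      unfolding r(3)[symmetric] by blast
    have "[h * r = r'] (mod int p)"
      by (simp add: h(2) cong_def)
    then show "r = r'"
      by (rule orbit_reps_unique[OF assms r(1,2) h(1)])
  next
    fix X assume "X \<in> ?f ` R"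
    then show "X \<in> H_orbits p H (orbit_domain p H \<chi>)"
      using assms by (auto simp: complete_orbit_reps_def H_orbits_eq)
  next
    fix X assume X: "X \<in> H_orbits p H (orbit_domain p H \<chi>)"
    then obtain x where x: "X = ?f x"
      by (auto simp: H_orbits_eq)
    obtain r where r: "r \<in> R" "r \<in> X"
      using assms X unfolding complete_orbit_reps_def by blast
    from r(2) obtain h where h: "h \<in> H" "r = h * x mod int p"
      unfolding x by blast
    have "X = ?f r"
      unfolding x h(2) by (rule orbit_eq[OF h(1), symmetric])
    then show "X \<in> ?f ` R"
      using r(1) by (rule image_eqI)
  qed
qed

lemma inequivalent_reps:
  assumes "complete_orbit_reps p H (orbit_domain p H \<chi>) (set rs)" "distinct rs"
  shows "inequivalent (length rs) ((!) rs)"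
  unfolding inequivalent_def
proof (intro allI impI ballI)
  fix i j h
  assume "i < length rs" "j < length rs" "h \<in> H" "[h * rs ! i = rs ! j] (mod int p)"
  moreover from this have "rs ! i = rs ! j"
    using orbit_reps_unique[OF assms(1)] nth_mem by blast
  ultimately show "i = j"
    using assms(2) by (simp add: nth_eq_iff_index_eq)
qed

end

theorem theorem5p5:
  fixes p :: nat and H R S :: "int set" and \<chi> :: "int \<Rightarrow> complex" and M :: "complex mat"
  assumes "prime p"
    and "subgroup H (units_of (Fp p))"
    and "is_character p H \<chi>"
    and "complete_orbit_reps p H (orbit_domain p H \<chi>) R"
    and "complete_orbit_reps p H (orbit_domain p H \<chi>) S"
    and "compressed_fourier_matrix p H \<chi> R S M"
  shows "nonvanishing_minors M"
proof -
  interpret subgroup_character p H \<chi>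
    by (rule subgroup_character.intro) (fact assms(1-3))+
  obtain rs ss where rs: "distinct rs" "set rs = R" and ss: "distinct ss" "set ss = S"
    and M: "M = mat (length rs) (length ss) (\<lambda>(i, j). eps_linear p (ss ! j) (u_elem p H \<chi> (rs ! i)))"
    using assms(6) unfolding compressed_fourier_matrix_def by blast
  have len: "length rs = length ss"
    using card_orbit_reps[OF assms(4)] card_orbit_reps[OF assms(5)]
    unfolding rs(2)[symmetric] ss(2)[symmetric] by (simp add: distinct_card rs(1) ss(1))
  show ?thesis
    unfolding nonvanishing_minors_def
  proof (intro conjI allI impI)
    show "square_mat M"
      by (simp add: M len)
  next
    fix I J assume IJ: "I \<subseteq> {..<dim_row M}" "J \<subseteq> {..<dim_col M}" "card I = card J" "1 \<le> card I"
    \<comment> \<open>\<open>submatrix\<close> filters its index sets by range; here the filter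
      changes nothing.\<close>
    have I: "{i. i < dim_row M \<and> i \<in> I} = I" and J: "{j. j < dim_col M \<and> j \<in> J} = J"
      using IJ by auto
    have pick_less: "pick I i < length rs" "pick J i < length ss" if "i < card I" for i
      using that IJ pick_in_set_le[of i I] pick_in_set_le[of i J] by (auto simp: M)
    \<comment> \<open>Counting the smaller elements of \<open>K\<close> recovers the position of a
      picked element.\<close>
    have inj: "inj_on (pick K) {..<card K}" for K
      by (rule inj_on_inverseI[where g = "\<lambda>m. card {a \<in> K. a < m}"]) (simp add: card_pick_le)
    have "submatrix M I J
        = mat (card I) (card I) (\<lambda>(i, j). gauss_sum (rs ! pick I i * ss ! pick J j))"
      unfolding submatrix_def I J IJ(3)[symmetric]
      using pick_less by (intro cong_mat) (auto simp: M eps_linear_eq_gauss_sum)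
    also have "det \<dots> \<noteq> 0"
    proof (rule det_gauss_sum_nonzero)
      show "inequivalent (card I) (\<lambda>i. rs ! pick I i)"
        using assms(4) rs by (intro inequivalent_comp[OF inequivalent_reps inj pick_less(1)]) simp_all
      show "inequivalent (card I) (\<lambda>i. ss ! pick J i)"
        using assms(5) ss inj[of J]
        by (intro inequivalent_comp[OF inequivalent_reps _ pick_less(2)]) (simp_all add: IJ(3))
      show "trivial_character H \<chi> \<or>
          (\<forall>i<card I. \<not> int p dvd rs ! pick I i \<and> \<not> int p dvd ss ! pick J i)"
      proof (cases "trivial_character H \<chi>")
        case False
        have "R \<subseteq> orbit_domain p H \<chi>" "S \<subseteq> orbit_domain p H \<chi>"
          using assms(4,5) by (simp_all add: complete_orbit_reps_def)
        moreover have "rs ! pick I i \<in> R" "ss ! pick J i \<in> S" if "i < card I" for i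
          using nth_mem[OF pick_less(1)[OF that]] nth_mem[OF pick_less(2)[OF that]] rs(2) ss(2) by simp_all
        ultimately have "\<not> int p dvd rs ! pick I i" "\<not> int p dvd ss ! pick J i" if "i < card I" for i
          using that by (meson orbit_domain_not_dvd[OF False] subsetD)+
        then show ?thesis
          by simp
      qed simp
    qed
    finally show "det (submatrix M I J) \<noteq> 0" .
  qed
qed

end
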